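(* Let $n\ge 1$. The number of parking functions of $1,\ldots,n$ for which the $n$-th spot is lucky is \[ \sum_{i=1}^nq_n(i,n)=\sum_{i=1}^nn^{n-2}=n^{n-1}. \]
   Context: There are $n$ spots labeled $1,\ldots,n$ in order along a one-way street, and $n$ cars entering one after another, car $i$ having preference $a_i\in\{1,\ldots,n\}$. Each car drives to its preferred spot and parks there if it is available; otherwise it moves forward and parks in the first available later spot, if any (if none, it fails to park). A parking function of $1,\ldots,n$ is a sequence of preferences $(a_1,\ldots,a_n)$ such that all $n$ cars are able to park. A car is lucky if it parks in its preferred spot; a spot is lucky if the car that parks in it prefers that spot. For $1\le i,j\le n$, $q_n(i,j)$ denotes the number of parking functions of $1,\ldots,n$ in which the $i$-th car prefers the $j$-th spot and the $i$-th car is lucky. Negative exponents are interpreted in the rational numbers. *)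

theory Defs
  imports Complex_Main
begin

text \<open>
  A preference sequence \<open>(a\<^sub>1, \<dots>, a\<^sub>n)\<close> is the list \<open>as\<close> of length \<open>n\<close> with \<open>as ! (i - 1) = a\<^sub>i\<close>;
  cars and spots keep their labels \<open>1, \<dots>, n\<close>.
\<close>

definition available :: "nat \<Rightarrow> nat set \<Rightarrow> nat \<Rightarrow> nat set" where
  "available n B a = {s. a \<le> s \<and> s \<le> n \<and> s \<notin> B}"

definition parks_at :: "nat \<Rightarrow> nat set \<Rightarrow> nat \<Rightarrow> nat option" where
  "parks_at n B a = (if available n B a = {} then None else Some (Min (available n B a)))"

text \<open>
  \<open>park_from n B as\<close> lists, in order of entrance, the spots in which the cars with preferences \<open>as\<close>
  park (\<open>None\<close> if the car fails to park) when the spots in \<open>B\<close> are already occupied.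
\<close>

fun park_from :: "nat \<Rightarrow> nat set \<Rightarrow> nat list \<Rightarrow> nat option list" where
  "park_from n B [] = []"
| "park_from n B (a # as) = parks_at n B a # park_from n (B \<union> set_option (parks_at n B a)) as"

definition parking_spot :: "nat \<Rightarrow> nat list \<Rightarrow> nat \<Rightarrow> nat option" where
  "parking_spot n as i = park_from n {} as ! (i - 1)"

definition preference :: "nat list \<Rightarrow> nat \<Rightarrow> nat" where
  "preference as i = as ! (i - 1)"

definition parking_functions :: "nat \<Rightarrow> nat list set" where
  "parking_functions n =
     {as. length as = n \<and> set as \<subseteq> {1..n} \<and> (\<forall>i\<in>{1..n}. parking_spot n as i \<noteq> None)}"

definition lucky_car :: "nat \<Rightarrow> nat list \<Rightarrow> nat \<Rightarrow> bool" where
  "lucky_car n as i \<longleftrightarrow> parking_spot n as i = Some (preference as i)"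

definition lucky_spot :: "nat \<Rightarrow> nat list \<Rightarrow> nat \<Rightarrow> bool" where
  "lucky_spot n as j \<longleftrightarrow> (\<exists>i\<in>{1..n}. parking_spot n as i = Some j \<and> preference as i = j)"

definition q :: "nat \<Rightarrow> nat \<Rightarrow> nat \<Rightarrow> nat" where
  "q n i j = card {as \<in> parking_functions n. preference as i = j \<and> lucky_car n as i}"

end

theory Submission
  imports Defs
begin

text \<open>
  In a parking function at most one car prefers spot \<open>n\<close>, and if spot \<open>n\<close> is lucky, deleting the car
  that parks there leaves a parking function of \<open>1, \<dots>, n - 1\<close>; conversely a car preferring \<open>n\<close> can be
  inserted at any of the \<open>n\<close> places of such a function. So the count is \<open>n\<close> times the number of
  parking functions of \<open>1, \<dots>, n - 1\<close>, and Pollak's circle argument shows that this product is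
  \<open>n ^ (n - 1)\<close>: let \<open>n - 1\<close> cars with preferences modulo \<open>n\<close> park on a circle of \<open>n\<close> spots. Exactly one
  spot stays empty, by rotational symmetry each spot is the empty one equally often, and
  spot \<open>0\<close> stays empty exactly for the parking functions of \<open>1, \<dots>, n - 1\<close>.
\<close>

section \<open>Linear parking\<close>

definition occupied :: "nat \<Rightarrow> nat set \<Rightarrow> nat list \<Rightarrow> nat set" where
  "occupied n B as = B \<union> {s. Some s \<in> set (park_from n B as)}"

lemma occupied_Nil [simp]: "occupied n B [] = B"
  by (simp add: occupied_def)

lemma occupied_Cons [simp]:
  "occupied n B (a # as) = occupied n (B \<union> set_option (parks_at n B a)) as"
  by (auto simp: occupied_def)

lemma length_park_from [simp]: "length (park_from n B as) = length as"
  by (induction as arbitrary: B) auto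

lemma park_from_append:
  "park_from n B (xs @ ys) = park_from n B xs @ park_from n (occupied n B xs) ys"
  by (induction xs arbitrary: B) auto

lemma finite_available [simp]: "finite (available n B a)"
  by (rule finite_subset[of _ "{..n}"]) (auto simp: available_def)

lemma parks_at_SomeD:
  assumes "parks_at n B a = Some s"
  shows "s \<in> available n B a" "\<And>t. t \<in> available n B a \<Longrightarrow> s \<le> t"
proof -
  have "available n B a \<noteq> {}" "s = Min (available n B a)"
    using assms by (auto simp: parks_at_def split: if_splits)
  then show "s \<in> available n B a" "\<And>t. t \<in> available n B a \<Longrightarrow> s \<le> t"
    using Min_in[OF finite_available] Min_le[OF finite_available] by metis+
qed

lemma parks_at_SomeI:
  assumes "s \<in> available n B a" "\<And>t. t \<in> available n B a \<Longrightarrow> s \<le> t"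
  shows "parks_at n B a = Some s"
  using assms by (auto simp: parks_at_def intro!: Min_eqI)

lemma parks_at_None_iff: "parks_at n B a = None \<longleftrightarrow> available n B a = {}"
  by (simp add: parks_at_def)

lemma park_from_notin:
  assumes "Some s \<in> set (park_from n B as)"
  shows "s \<notin> B"
  using assms
proof (induction as arbitrary: B)
  case Nil
  then show ?case by simp
next
  case (Cons a as)
  show ?case
  proof (cases "parks_at n B a = Some s")
    case True
    then show ?thesis using parks_at_SomeD(1) by (auto simp: available_def)
  next
    case False
    then show ?thesis using Cons.IH[of "B \<union> set_option (parks_at n B a)"] Cons.prems by auto
  qed
qed

text \<open>A spot, once taken, belongs to the occupied set seen by every later car. This is what
  makes the car parked in a given spot unique.\<close>

lemma park_from_inj:
  assumes "i < j" "j < length as" "park_from n B as ! i = Some s"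
  shows "park_from n B as ! j \<noteq> Some s"
  using assms
proof (induction as arbitrary: B i j)
  case Nil
  then show ?case by simp
next
  case (Cons a as)
  then obtain j' where j: "j = Suc j'" by (cases j) auto
  show ?case
  proof (cases i)
    case 0
    then have "s \<in> B \<union> set_option (parks_at n B a)" using Cons.prems by simp
    then have "Some s \<notin> set (park_from n (B \<union> set_option (parks_at n B a)) as)"
      using park_from_notin by blast
    moreover have "park_from n (B \<union> set_option (parks_at n B a)) as ! j'
        \<in> set (park_from n (B \<union> set_option (parks_at n B a)) as)"
      using Cons.prems j by (intro nth_mem) simp
    ultimately show ?thesis using j by auto
  next
    case (Suc i')
    then show ?thesis using Cons j by simp
  qed
qed

lemma parking_functions_alt:
  "parking_functions n =
     {as. length as = n \<and> set as \<subseteq> {1..n} \<and> None \<notin> set (park_from n {} as)}"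
proof -
  have "(\<forall>i\<in>{1..n}. parking_spot n as i \<noteq> None) \<longleftrightarrow> None \<notin> set (park_from n {} as)"
    if len: "length as = n" for as
  proof
    assume *: "\<forall>i\<in>{1..n}. parking_spot n as i \<noteq> None"
    show "None \<notin> set (park_from n {} as)"
    proof
      assume "None \<in> set (park_from n {} as)"
      then obtain k where "k < n" "park_from n {} as ! k = None"
        using len by (auto simp: in_set_conv_nth)
      then show False
        using *[rule_format, of "Suc k"] by (simp add: parking_spot_def)
    qed
  next
    assume *: "None \<notin> set (park_from n {} as)"
    show "\<forall>i\<in>{1..n}. parking_spot n as i \<noteq> None"
    proof
      fix i assume "i \<in> {1..n}"
      then have "park_from n {} as ! (i - 1) \<in> set (park_from n {} as)"
        using len by (intro nth_mem) auto
      then show "parking_spot n as i \<noteq> None"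
        using * unfolding parking_spot_def by metis
    qed
  qed
  then show ?thesis by (auto simp: parking_functions_def)
qed

lemma finite_parking_functions: "finite (parking_functions n)"
  by (rule finite_subset[OF _ finite_lists_length_eq[of "{1..n}" n]])
    (auto simp: parking_functions_alt)

section \<open>Removing the last spot\<close>

lemma parks_at_Suc_last_occupied: "parks_at (Suc m) (insert (Suc m) B) a = parks_at m B a"
proof -
  have "available (Suc m) (insert (Suc m) B) a = available m B a"
    by (auto simp: available_def)
  then show ?thesis by (simp add: parks_at_def)
qed

lemma park_from_Suc_last_occupied:
  "park_from (Suc m) (insert (Suc m) B) as = park_from m B as"
  by (induction as arbitrary: B) (auto simp: parks_at_Suc_last_occupied)

text \<open>The extra spot lies behind all others, so it is the minimum of the available spots only
  when nothing else is available.\<close>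

lemma parks_at_Suc_last_free:
  assumes "Suc m \<notin> B" "a \<le> Suc m"
  shows "parks_at (Suc m) B a =
    (case parks_at m B a of None \<Rightarrow> Some (Suc m) | Some s \<Rightarrow> Some s)"
proof (cases "parks_at m B a")
  case None
  then have "available m B a = {}" by (simp add: parks_at_None_iff)
  then have "available (Suc m) B a = {Suc m}"
    using assms by (auto simp: available_def le_Suc_eq)
  then show ?thesis using None by (simp add: parks_at_def)
next
  case (Some s)
  note s = parks_at_SomeD[OF Some]
  have "parks_at (Suc m) B a = Some s"
  proof (rule parks_at_SomeI)
    show "s \<in> available (Suc m) B a" using s(1) by (auto simp: available_def)
    fix t assume "t \<in> available (Suc m) B a"
    then show "s \<le> t" using s(1) s(2)[of t] by (auto simp: available_def le_Suc_eq)
  qed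
  then show ?thesis using Some by simp
qed

text \<open>The streets of lengths \<open>m\<close> and \<open>Suc m\<close> evolve alike until the
  first failure on the shorter one, and exactly that car fills spot \<open>Suc m\<close>.\<close>

lemma park_from_Suc_last_free_iff:
  assumes "Suc m \<notin> B" "set as \<subseteq> {1..Suc m}"
  shows "Suc m \<notin> occupied (Suc m) B as \<longleftrightarrow> None \<notin> set (park_from m B as)"
  using assms
proof (induction as arbitrary: B)
  case Nil
  then show ?case by simp
next
  case (Cons a as)
  note eq = parks_at_Suc_last_free[OF Cons.prems(1), of a]
  show ?case
  proof (cases "parks_at m B a")
    case None
    then show ?thesis using eq Cons.prems by (auto simp: occupied_def)
  next
    case (Some s)
    then have "s \<le> m" using parks_at_SomeD(1)[OF Some] by (simp add: available_def)
    then show ?thesis using eq Cons.prems Cons.IH[of "insert s B"] Some by simp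
  qed
qed

lemma park_from_Suc_last_free:
  assumes "Suc m \<notin> B" "set as \<subseteq> {1..Suc m}" "None \<notin> set (park_from m B as)"
  shows "park_from (Suc m) B as = park_from m B as"
  using assms
proof (induction as arbitrary: B)
  case Nil
  then show ?case by simp
next
  case (Cons a as)
  note eq = parks_at_Suc_last_free[OF Cons.prems(1), of a]
  obtain s where s: "parks_at m B a = Some s" using Cons.prems(3) by fastforce
  then have "s \<le> m" using parks_at_SomeD(1)[OF s] by (simp add: available_def)
  then show ?case using eq Cons.prems Cons.IH[of "insert s B"] s by simp
qed

lemma park_from_pref_le:
  assumes "None \<notin> set (park_from m B as)" "a \<in> set as"
  shows "a \<le> m"
  using assms
proof (induction as arbitrary: B)
  case Nil
  then show ?case by simp
next
  case (Cons b as)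
  obtain s where s: "parks_at m B b = Some s" using Cons.prems(1) by fastforce
  have "b \<le> m" using parks_at_SomeD(1)[OF s] by (simp add: available_def)
  then show ?case using Cons by auto
qed

text \<open>Before the inserted car arrives, spot \<open>Suc m\<close> must stay free, so the cars
  of \<open>xs\<close> park as on the shorter street. Afterwards the spot is blocked, so the cars of
  \<open>ys\<close> do too.\<close>

lemma parking_function_insert_last_iff:
  assumes "set xs \<subseteq> {1..Suc m}" "set ys \<subseteq> {1..Suc m}" 
    "length xs + length ys = m"
  shows "xs @ Suc m # ys \<in> parking_functions (Suc m)
      \<and> lucky_car (Suc m) (xs @ Suc m # ys) (Suc (length xs))
    \<longleftrightarrow> xs @ ys \<in> parking_functions m"
proof -
  let ?n = "Suc m"
  define O1 where "O1 = occupied ?n {} xs"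
  have split: "park_from ?n {} (xs @ ?n # ys) = park_from ?n {} xs @ parks_at ?n O1 ?n #
      park_from ?n (O1 \<union> set_option (parks_at ?n O1 ?n)) ys"
    by (simp add: park_from_append O1_def)
  have last: "parks_at ?n O1 ?n = (if ?n \<in> O1 then None else Some ?n)"
  proof -
    have "available ?n O1 ?n = (if ?n \<in> O1 then {} else {?n})"
      by (auto simp: available_def)
    then show ?thesis by (simp add: parks_at_def)
  qed
  have lucky: "lucky_car ?n (xs @ ?n # ys) (Suc (length xs)) \<longleftrightarrow> ?n \<notin> O1"
    by (simp add: lucky_car_def parking_spot_def preference_def split nth_append last)
  have free: "?n \<notin> O1 \<longleftrightarrow> None \<notin> set (park_from m {} xs)"
    unfolding O1_def using assms(1) by (intro park_from_Suc_last_free_iff) auto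
  show ?thesis
  \<comment> \<open>If the spot is already taken, both sides fail: the inserted car is not lucky,
    and some car of \<open>xs\<close> finds no spot among \<open>1..m\<close>.\<close>
  proof (cases "?n \<in> O1")
    case True
    then show ?thesis using lucky free
      by (auto simp: parking_functions_alt park_from_append)
  next
    case False
    have xs: "park_from ?n {} xs = park_from m {} xs"
      using False free assms(1) by (intro park_from_Suc_last_free) auto
    then have O1: "O1 = occupied m {} xs" by (simp add: O1_def occupied_def)
    have "park_from ?n {} (xs @ ?n # ys) =
        park_from m {} xs @ Some ?n # park_from m (occupied m {} xs) ys"
      using False by (simp add: split last xs park_from_Suc_last_occupied flip: O1)
    then have "None \<notin> set (park_from ?n {} (xs @ ?n # ys))
        \<longleftrightarrow> None \<notin> set (park_from m {} (xs @ ys))"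
      by (simp only: park_from_append[of m]) simp
    \<comment> \<open>The assumptions still allow the preference \<open>Suc m\<close> in
      \<open>xs\<close> and \<open>ys\<close>; a car that parks among \<open>1..m\<close> cannot
      have it.\<close>
    moreover have "set (xs @ ys) \<subseteq> {1..m}" if "None \<notin> set (park_from m {} (xs @ ys))"
      using park_from_pref_le[OF that] assms by fastforce
    ultimately show ?thesis
      using False lucky assms by (auto simp: parking_functions_alt)
  qed
qed

text \<open>Inserting and deleting the preference of car \<open>i\<close> are mutually inverse,
  whatever its position, so the count does not depend on \<open>i\<close>.\<close>

lemma q_last:
  assumes "i \<in> {1..Suc m}"
  shows "q (Suc m) i (Suc m) = card (parking_functions m)"
proof -
  let ?n = "Suc m"
  let ?S = "{as \<in> parking_functions ?n. preference as i = ?n \<and> lucky_car ?n as i}"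
  let ?ins = "\<lambda>bs. take (i - 1) bs @ ?n # drop (i - 1) bs"
  let ?del = "\<lambda>as. take (i - 1) as @ drop i as"
  have i: "i - 1 \<le> m" "Suc (i - 1) = i" using assms by auto
  have "bij_betw ?ins (parking_functions m) ?S"
  proof (rule bij_betw_byWitness[where f' = ?del])
    show "\<forall>bs\<in>parking_functions m. ?del (?ins bs) = bs"
    proof
      fix bs assume "bs \<in> parking_functions m"
      then have "length bs = m" by (simp add: parking_functions_alt)
      moreover obtain k where "i = Suc k" using i by metis
      ultimately show "?del (?ins bs) = bs" using i by simp
    qed
    have decomp: "?ins (?del as) = as \<and> ?del as \<in> parking_functions m" if "as \<in> ?S" for as
    proof -
      let ?xs = "take (i - 1) as" and ?ys = "drop i as"
      from that have len: "length as = ?n" and nth: "as ! (i - 1) = ?n"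
        and sub: "set as \<subseteq> {1..?n}"
        by (auto simp: parking_functions_alt preference_def)
      have as: "as = ?xs @ ?n # ?ys"
        using id_take_nth_drop[of "i - 1" as] len nth i by simp
      have "set ?xs \<subseteq> {1..?n}" "set ?ys \<subseteq> {1..?n}" "length ?xs + length ?ys = m"
        and lxs: "Suc (length ?xs) = i"
        using sub set_take_subset[of "i - 1" as] set_drop_subset[of i as] len i by auto
      note iff = parking_function_insert_last_iff[OF this(1-3)]
      have "?del as \<in> parking_functions m"
        using iff that unfolding as[symmetric] lxs by blast
      moreover have "take (i - 1) (?del as) = ?xs" "drop (i - 1) (?del as) = ?ys"
        using len i by simp_all
      then have "?ins (?del as) = as" by (simp only: as[symmetric])
      ultimately show ?thesis by blast
    qed
    then show "\<forall>as\<in>?S. ?ins (?del as) = as" "?del ` ?S \<subseteq> parking_functions m"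
      by blast+
    show "?ins ` parking_functions m \<subseteq> ?S"
    proof (rule image_subsetI)
      fix bs assume bs: "bs \<in> parking_functions m"
      let ?xs = "take (i - 1) bs" and ?ys = "drop (i - 1) bs"
      from bs have len: "length bs = m" and sub: "set bs \<subseteq> {1..m}"
        by (auto simp: parking_functions_alt)
      have "set ?xs \<subseteq> {1..?n}" "set ?ys \<subseteq> {1..?n}" "length ?xs + length ?ys = m"
        and lxs: "Suc (length ?xs) = i"
        using sub set_take_subset[of "i - 1" bs] set_drop_subset[of "i - 1" bs] len i
        by fastforce+
      then have "?ins bs \<in> parking_functions ?n \<and> lucky_car ?n (?ins bs) i"
        using parking_function_insert_last_iff[of ?xs m ?ys] bs by auto
      moreover have "preference (?ins bs) i = ?n"
        using lxs by (simp add: preference_def nth_append)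
      ultimately show "?ins bs \<in> ?S" by blast
    qed
  qed
  then show ?thesis unfolding q_def by (rule bij_betw_same_card[symmetric])
qed

section \<open>Circular parking\<close>

text \<open>Spots on the circle are residues modulo \<open>N\<close>, and the \<open>LEAST\<close>
  counts the steps driven. The value is meaningful only while some residue is free.\<close>

definition circ_spot :: "nat \<Rightarrow> nat set \<Rightarrow> nat \<Rightarrow> nat" where
  "circ_spot N B a = (a + (LEAST k. (a + k) mod N \<notin> B)) mod N"

fun circ_occupied :: "nat \<Rightarrow> nat set \<Rightarrow> nat list \<Rightarrow> nat set" where
  "circ_occupied N B [] = B"
| "circ_occupied N B (a # as) = circ_occupied N (insert (circ_spot N B a) B) as"

definition rot :: "nat \<Rightarrow> nat \<Rightarrow> nat \<Rightarrow> nat" where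
  "rot N c x = (x + c) mod N"

lemma rot_less: "N > 0 \<Longrightarrow> rot N c x < N"
  by (simp add: rot_def)

lemma inj_on_rot: "inj_on (rot N c) {..<N}"
proof (rule inj_onI)
  fix x y assume "x \<in> {..<N}" "y \<in> {..<N}" "rot N c x = rot N c y"
  then have "(x + c) mod N = (y + c) mod N" "x < N" "y < N" by (simp_all add: rot_def)
  moreover from this obtain k l where "x + c + N * k = y + c + N * l"
    by (auto simp: nat_mod_eq_iff)
  then have "x + N * k = y + N * l" by simp
  then have "x mod N = y mod N" by (auto simp: nat_mod_eq_iff)
  ultimately show "x = y" by simp
qed

lemma circ_spot_notin:
  assumes "B \<subset> {..<N}" "a < N"
  shows "circ_spot N B a \<in> {..<N} - B"
proof -
  obtain t where t: "t < N" "t \<notin> B" using assms(1) by auto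
  \<comment> \<open>The free spot \<open>t\<close> is reached after \<open>t + N - a\<close> steps;
    adding \<open>N\<close> keeps the natural subtraction from truncating when
    \<open>t < a\<close>.\<close>
  have "(a + (t + N - a)) mod N \<notin> B" using t assms(2) by simp
  then have "(a + (LEAST k. (a + k) mod N \<notin> B)) mod N \<notin> B" by (rule LeastI)
  then show ?thesis using assms by (simp add: circ_spot_def)
qed

text \<open>Rotation commutes with driving \<open>k\<close> steps and is injective on residues, so
  the rotated car drives equally far.\<close>

lemma circ_spot_rot:
  assumes "B \<subseteq> {..<N}" "N > 0"
  shows "circ_spot N (rot N c ` B) (rot N c a) = rot N c (circ_spot N B a)"
proof -
  have shift: "(rot N c a + k) mod N = rot N c ((a + k) mod N)" for k
    by (simp add: rot_def mod_simps ac_simps)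
  have "(rot N c a + k) mod N \<notin> rot N c ` B \<longleftrightarrow> (a + k) mod N \<notin> B" for k
    unfolding shift using assms by (subst inj_on_image_mem_iff[OF inj_on_rot]) auto
  then show ?thesis unfolding circ_spot_def by (simp add: shift)
qed

text \<open>The strict bound leaves a free spot for each arriving car, so every car adds exactly one
  new spot.\<close>

lemma circ_occupied_card:
  assumes "B \<subseteq> {..<N}" "set as \<subseteq> {..<N}" "card B + length as < N"
  shows "circ_occupied N B as \<subseteq> {..<N} \<and> card (circ_occupied N B as) = card B + length as"
  using assms
proof (induction as arbitrary: B)
  case Nil
  then show ?case by simp
next
  case (Cons a as)
  have "B \<subset> {..<N}" using Cons.prems by auto
  then have s: "circ_spot N B a \<in> {..<N} - B" using circ_spot_notin Cons.prems by simp
  have "finite B" using Cons.prems(1) finite_subset by blast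
  then have "card (insert (circ_spot N B a) B) = Suc (card B)" using s by simp
  then show ?case using Cons.IH[of "insert (circ_spot N B a) B"] Cons.prems s by simp
qed

lemma circ_occupied_rot:
  assumes "B \<subseteq> {..<N}" "set as \<subseteq> {..<N}" "card B + length as < N"
  shows "circ_occupied N (rot N c ` B) (map (rot N c) as) = rot N c ` circ_occupied N B as"
  using assms
proof (induction as arbitrary: B)
  case Nil
  then show ?case by simp
next
  case (Cons a as)
  have "B \<subset> {..<N}" using Cons.prems by auto
  then have s: "circ_spot N B a \<in> {..<N} - B" using circ_spot_notin Cons.prems by simp
  have "finite B" using Cons.prems(1) finite_subset by blast
  then have "card (insert (circ_spot N B a) B) = Suc (card B)" using s by simp
  then show ?case
    using Cons.IH[of "insert (circ_spot N B a) B"] Cons.prems s by (simp add: circ_spot_rot)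
qed

lemma circ_occupied_mono: "B \<subseteq> circ_occupied N B as"
proof (induction as arbitrary: B)
  case (Cons a as)
  show ?case unfolding circ_occupied.simps by (rule subset_trans[OF subset_insertI Cons.IH])
qed simp

section \<open>Comparison of the circle with the street\<close>

text \<open>The case \<open>t = N\<close> is the wrap-around: the car passes \<open>a\<close>, ...,
  \<open>N - 1\<close> and ends in spot \<open>0\<close>.\<close>

lemma circ_spot_eqI:
  assumes "a \<le> t" "t \<le> N" "t mod N \<notin> B" "\<And>s. a \<le> s \<Longrightarrow> s < t \<Longrightarrow> s \<in> B"
  shows "circ_spot N B a = t mod N"
proof -
  have "(LEAST k. (a + k) mod N \<notin> B) = t - a"
  proof (rule Least_equality)
    show "(a + (t - a)) mod N \<notin> B" using assms by simp
  next
    fix k assume k: "(a + k) mod N \<notin> B"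
    show "t - a \<le> k"
    proof (rule ccontr)
      assume "\<not> t - a \<le> k"
      then have "a + k < t" by simp
      then show False using k assms(2) assms(4)[of "a + k"] by simp
    qed
  qed
  then show ?thesis using assms by (simp add: circ_spot_def)
qed

text \<open>Residues \<open>1..m\<close> form the street and \<open>0\<close> is the spot right
  behind \<open>m\<close>, where a car that would fail on the street ends up.\<close>

lemma circ_spot_linear:
  assumes "0 \<notin> B" "a \<in> {1..m}"
  shows "circ_spot (Suc m) B a = (case parks_at m B a of None \<Rightarrow> 0 | Some s \<Rightarrow> s)"
proof (cases "parks_at m B a")
  case None
  then have "\<And>s. a \<le> s \<Longrightarrow> s < Suc m \<Longrightarrow> s \<in> B"
    by (auto simp: parks_at_None_iff available_def)
  then have "circ_spot (Suc m) B a = Suc m mod Suc m"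
    using assms by (intro circ_spot_eqI) auto
  then show ?thesis using None by simp
next
  case (Some s)
  note s = parks_at_SomeD[OF Some]
  have s': "a \<le> s" "s \<le> m" "s \<notin> B" using s(1) by (auto simp: available_def)
  have "circ_spot (Suc m) B a = s mod Suc m"
  proof (rule circ_spot_eqI)
    fix t assume "a \<le> t" "t < s"
    then show "t \<in> B" using s(2)[of t] s' by (force simp: available_def)
  qed (use s' in auto)
  then show ?thesis using Some s' by simp
qed

text \<open>Spot \<open>0\<close> is filled by the first car that prefers it or fails on the street,
  and by \<open>circ_occupied_mono\<close> it then stays filled.\<close>

lemma circ_occupied_zero_iff:
  assumes "0 \<notin> B" "set as \<subseteq> {..<Suc m}"
  shows "0 \<notin> circ_occupied (Suc m) B as
    \<longleftrightarrow> set as \<subseteq> {1..m} \<and> None \<notin> set (park_from m B as)"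
  using assms
proof (induction as arbitrary: B)
  case Nil
  then show ?case by simp
next
  case (Cons a as)
  have filled: "0 \<in> circ_occupied (Suc m) B (a # as)" if "circ_spot (Suc m) B a = 0"
    using that circ_occupied_mono[of "insert 0 B" "Suc m" as] by auto
  show ?case
  proof (cases "a = 0")
    case True
    have "circ_spot (Suc m) B 0 = 0 mod Suc m"
      using Cons.prems by (intro circ_spot_eqI) auto
    then show ?thesis using True filled by auto
  next
    case False
    then have a: "a \<in> {1..m}" using Cons.prems by auto
    note spot = circ_spot_linear[OF Cons.prems(1) a]
    show ?thesis
    proof (cases "parks_at m B a")
      case None
      then show ?thesis using spot filled by auto
    next
      case (Some s)
      then have "s \<noteq> 0" using parks_at_SomeD(1)[OF Some] a by (auto simp: available_def)
      then show ?thesis using Some spot a Cons.prems Cons.IH[of "insert s B"] by auto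
    qed
  qed
qed

section \<open>Pollak's count of parking functions\<close>

text \<open>The product form avoids the exponent \<open>m - 1\<close>, which would be negative for
  \<open>m = 0\<close>, and is the quantity that the lucky-spot count needs.\<close>

lemma card_parking_functions: "Suc m * card (parking_functions m) = Suc m ^ m"
proof -
  let ?N = "Suc m"
  define L where "L = {as. set as \<subseteq> {..<?N} \<and> length as = m}"
  \<comment> \<open>These classes, indexed by the spot left empty, partition \<open>L\<close> into
    \<open>?N\<close> sets of equal size.\<close>
  define A where "A c = {as \<in> L. c \<notin> circ_occupied ?N {} as}" for c
  have fin: "finite L" and cardL: "card L = ?N ^ m"
    unfolding L_def
    using finite_lists_length_eq[of "{..<?N}" m] card_lists_length_eq[of "{..<?N}" m] by auto
  have finA: "finite (A c)" for c using fin by (simp add: A_def)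
  have occ: "circ_occupied ?N {} as \<subseteq> {..<?N}" "card (circ_occupied ?N {} as) = m"
    if "as \<in> L" for as
    using circ_occupied_card[of "{}" ?N as] that by (auto simp: L_def)
  have unique: "\<exists>c. {..<?N} - circ_occupied ?N {} as = {c}" if "as \<in> L" for as
  proof -
    have "card ({..<?N} - circ_occupied ?N {} as) = 1"
      using occ[OF that] finite_subset by (subst card_Diff_subset) auto
    then show ?thesis by (simp add: card_1_singleton_iff)
  qed
  have rot_le: "card (A c) \<le> card (A (rot ?N d c))" if "c < ?N" for c d
  proof (rule card_inj_on_le[OF _ _ finA])
    show "inj_on (map (rot ?N d)) (A c)"
    proof (rule inj_on_subset[OF inj_on_mapI[of _ L]])
      show "inj_on (rot ?N d) (\<Union> (set ` L))"
        by (rule inj_on_subset[OF inj_on_rot]) (auto simp: L_def)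
    qed (auto simp: A_def)
    show "map (rot ?N d) ` A c \<subseteq> A (rot ?N d c)"
    proof (rule image_subsetI)
      fix as assume as: "as \<in> A c"
      then have "as \<in> L" by (simp add: A_def)
      have "map (rot ?N d) as \<in> L" using \<open>as \<in> L\<close> by (auto simp: L_def rot_less)
      moreover have "circ_occupied ?N {} (map (rot ?N d) as)
          = rot ?N d ` circ_occupied ?N {} as"
        using circ_occupied_rot[of "{}" ?N as d] \<open>as \<in> L\<close> by (auto simp: L_def)
      moreover have "rot ?N d c \<notin> rot ?N d ` circ_occupied ?N {} as"
        using occ(1)[OF \<open>as \<in> L\<close>] that as
        by (subst inj_on_image_mem_iff[OF inj_on_rot]) (auto simp: A_def)
      ultimately show "map (rot ?N d) as \<in> A (rot ?N d c)" by (simp add: A_def)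
    qed
  qed
  \<comment> \<open>Rotation by \<open>c\<close> carries \<open>0\<close> to \<open>c\<close>, and
    rotation by \<open>?N - c\<close> carries \<open>c\<close> back to \<open>0\<close>; the two
    inequalities give equality.\<close>
  have same: "card (A c) = card (A 0)" if "c < ?N" for c
    using rot_le[of 0 c] rot_le[of c "?N - c"] that by (simp add: rot_def)
  have A_zero: "A 0 = parking_functions m"
    using circ_occupied_zero_iff[of "{}" _ m]
    by (fastforce simp: A_def L_def parking_functions_alt)
  have L_eq: "L = (\<Union>c\<in>{..<?N}. A c)"
    using unique by (fastforce simp: A_def)
  have "A c \<inter> A d = {}" if "c < ?N" "d < ?N" "c \<noteq> d" for c d
  proof -
    have False if "as \<in> L" "c \<notin> circ_occupied ?N {} as" "d \<notin> circ_occupied ?N {} as" for as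
    proof -
      obtain e where "{..<?N} - circ_occupied ?N {} as = {e}" using unique \<open>as \<in> L\<close> by blast
      then have "c \<in> {e}" "d \<in> {e}" using that \<open>c < ?N\<close> \<open>d < ?N\<close> by auto
      then show False using \<open>c \<noteq> d\<close> by simp
    qed
    then show ?thesis by (auto simp: A_def)
  qed
  then have "card (\<Union>c\<in>{..<?N}. A c) = (\<Sum>c<?N. card (A c))"
    using finA by (intro card_UN_disjoint) auto
  also have "\<dots> = (\<Sum>c<?N. card (A 0))" by (intro sum.cong refl same) simp
  finally have "card L = ?N * card (A 0)" unfolding L_eq by simp
  then show ?thesis using cardL A_zero by metis
qed

section \<open>Lucky last spot\<close>

text \<open>Only one car parks in spot \<open>j\<close>, so classifying by that car splits the set
  into disjoint classes of sizes \<open>q n i j\<close>.\<close>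

lemma card_lucky_spot:
  "card {as \<in> parking_functions n. lucky_spot n as j} = (\<Sum>i=1..n. q n i j)"
proof -
  let ?S = "\<lambda>i. {as \<in> parking_functions n. preference as i = j \<and> lucky_car n as i}"
  have "{as \<in> parking_functions n. lucky_spot n as j} = (\<Union>i\<in>{1..n}. ?S i)"
    by (auto simp: lucky_spot_def lucky_car_def)
  moreover have disj: "?S i \<inter> ?S k = {}" if "i \<in> {1..n}" "k \<in> {1..n}" "i < k" for i k
  proof -
    have "parking_spot n as k \<noteq> Some j"
      if "as \<in> parking_functions n" "parking_spot n as i = Some j" for as
      using park_from_inj[of "i - 1" "k - 1" as n "{}" j] that \<open>i \<in> _\<close> \<open>k \<in> _\<close> \<open>i < k\<close>
      by (auto simp: parking_functions_alt parking_spot_def)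
    then show ?thesis by (auto simp: lucky_car_def)
  qed
  moreover have "?S i \<inter> ?S k = {}" if "i \<in> {1..n}" "k \<in> {1..n}" "i \<noteq> k" for i k
    using disj[of i k] disj[of k i] that by (cases i k rule: linorder_cases) blast+
  ultimately show ?thesis
    unfolding q_def using finite_parking_functions[of n]
    by (simp only:) (rule card_UN_disjoint; simp)
qed

theorem mainTheorem10:
  fixes n :: nat
  assumes "n \<ge> 1"
  shows "card {as \<in> parking_functions n. lucky_spot n as n} = (\<Sum>i=1..n. q n i n)
    \<and> (of_nat (\<Sum>i=1..n. q n i n) :: rat) = (\<Sum>i=1..n. (of_nat n :: rat) powi (int n - 2))
    \<and> (\<Sum>i=1..n. (of_nat n :: rat) powi (int n - 2)) = (of_nat n :: rat) powi (int n - 1)"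
proof -
  obtain m where n: "n = Suc m" using assms by (cases n) auto
  have "(\<Sum>i=1..n. q n i n) = n * card (parking_functions m)"
    using q_last[of _ m] n by simp
  then have total: "(\<Sum>i=1..n. q n i n) = n ^ m" using card_parking_functions[of m] n by simp
  \<comment> \<open>Summing \<open>n\<close> equal terms contributes a factor \<open>n\<close>,
    raising the exponent by one. For \<open>n = 1\<close> the exponent \<open>int n - 2\<close> is
    \<open>-1\<close>.\<close>
  have "(\<Sum>i=1..n. (of_nat n :: rat) powi (int n - 2)) = of_nat n powi (int n - 2 + 1)"
    using assms by (subst power_int_add_1) auto
  then have const: "(\<Sum>i=1..n. (of_nat n :: rat) powi (int n - 2)) = of_nat n powi (int n - 1)"
    by simp
  have "(of_nat n :: rat) powi (int n - 1) = of_nat (n ^ m)"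
    by (simp add: n)
  then show ?thesis using card_lucky_spot total const by simp
qed

end
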